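(* Consider the closed loop generated by the online learning based risk-averse stochastic MPC algorithm with safe update scheme described in the context, under the assumptions listed there. For each $k$ let $\mathbb{D}(x_k)$ denote the feasible region (the set of feasible $\mathbf{c}_{N|k}$) of the finite-horizon optimal control problem (OL-SMPC$_k$) for state $x_k$. If $\mathbb{D}(x_0)\neq\emptyset$, then $\mathbb{D}(x_k)\neq\emptyset$ for all $k\ge 0$.
   Context: Notation: $[A]_i$ is the $i$-th row of a matrix, $[a]_i$ the $i$-th entry of a vector; $\oplus$ is the Minkowski sum, $\mathbb{A}\ominus\mathbb{B}=\{a\mid a\oplus\mathbb{B}\subseteq\mathbb{A}\}$; an empty Minkowski sum is $\{0\}$; $(\alpha)^+=\max(\alpha,0)$. System: $x_{k+1}=Ax_k+Bu_k+w_k$, $x_k\in\mathbb{R}^n$, $u_k\in\mathbb{R}^m$. Assumptions: (1) $x_k$ is measured at time $k$; (2) $(A,B)$ is controllable; (3) $w_k\in\mathbb{W}=\{w\mid Ew\le f\}$, a bounded convex set containing the origin in its interior; (4) $(A,Q^{1/2})$ is detectable, where $Q\succ0$, $R\succ0$ are cost matrices; (5) the worst-case terminal set defined below is nonempty. The (possibly time-varying) disturbance distribution is otherwise unknown. Constraints: $\mathbb{X}=\{x\mid Hx\le h\}$ with $H\in\mathbb{R}^{p\times n}$ and $\mathbb{U}=\{u\mid Gu\le g\}$, polytopic and containing the origin in their interiors. $K$ is the LQR-optimal gain for $(A,B,Q,R)$, $\Phi=A+BK$ is Schur stable, and $P$ solves $\Phi^TP\Phi+Q+K^TRK=P$. Horizon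 $N\ge1$. Tightened sets. Given risk levels $[\varepsilon]_i\in(0,1)$, at time $k$ there is an ambiguity set $\mathcal{D}^{(k)}=\{\sum_{j=1}^{m^{(k)}}\gamma_j^{(k)}\rho_j\}$, where $\rho_j$ ranges over the probability measures on $\mathbb{W}$ with mean $\mu_j^{(k)}$ and second moment matrix $\int\xi\xi^T\rho_j(d\xi)\preceq\Sigma_j^{(k)}+\mu_j^{(k)}(\mu_j^{(k)})^T$; the number of components $m^{(k)}$, weights $\gamma_j^{(k)}\ge0$ (summing to one), means and covariances are outputs at time $k$ of an online learning procedure applied to the disturbance data available up to time $k$, and are regarded as given data. Let $$[\eta^{(k)}]_i=\min\Big\{\eta\ \Big|\ \sup_{\mathbb{P}\in\mathcal{D}^{(k)}}\mathbb{P}\text{-CVaR}_{[\varepsilon]_i}([H]_iw-\eta)\le0\Big\},\quad \mathbb{P}\text{-CVaR}_\epsilon(L)=\inf_{\beta\in\mathbb{R}}\big\{\beta+\tfrac1\epsilon\mathbb{E}_{\mathbb{P}}[(L-\beta)^+]\big\},$$ where $w\sim\mathbb{P}$. Put $\tilde{\mathbb{Z}}^{(k)}=\{z\mid Hz\le h-\eta^{(k)}\}$, $\hat{\mathbb{Z}}_l^{(k)}=\tilde{\mathbb{Z}}^{(k)}\ominus\big(\bigoplus_{i=1}^{l-1}\Phi^i\mathbb{W}\big)$ for $l\ge1$, and $\mathbb{V}_l=\mathbb{U}\ominus K\big(\bigoplus_{i=0}^{l-1}\Phi^i\mathbb{W}\big)$ for $l\ge0$. Terminal set. A set $\Omega$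 is robust positively invariant for a system $x^+=F(x,w)$, state constraint set $\mathcal{X}$ and disturbance set $\mathbb{W}$ if $\Omega\subseteq\mathcal{X}$ and $F(x,w)\in\Omega$ for all $x\in\Omega$, $w\in\mathbb{W}$; it is maximal (MRPI) if it contains all robust positively invariant sets. $\hat{\mathbb{Z}}_f^{(k)}$ is the MRPI set for $z^+=\Phi z+\Phi^Nw$, $w\in\mathbb{W}$, with constraints $z\in\hat{\mathbb{Z}}_N^{(k)}$ and $Kz\in\mathbb{V}_N$. The worst-case terminal set $\mathbb{Z}_f^*$ is defined in the same way with $\eta^{(k)}$ replaced by $\eta_0$, $[\eta_0]_i=\max_{\xi\in\mathbb{W}}[H]_i\xi$; assumption (5) says $\mathbb{Z}_f^*\ne\emptyset$. Problem (OL-SMPC$_k$), for the current sets $\mathbb{Z}_l^{(k)}$ and $\mathbb{Z}_f^{(k)}$: minimize $J_N(\mathbf{c}_{N|k})=\sum_{l=0}^{N-1}c_{l|k}^T(R+B^TPB)c_{l|k}$ over $\mathbf{c}_{N|k}=(c_{0|k},\dots,c_{N-1|k})\in(\mathbb{R}^m)^N$ subject to $z_{0|k}=x_k$, and for $l=0,\dots,N-1$: $z_{l+1|k}=Az_{l|k}+Bv_{l|k}$, $v_{l|k}=Kz_{l|k}+c_{l|k}$, $z_{l+1|k}\in\mathbb{Z}_{l+1}^{(k)}$, $v_{l|k}\in\mathbb{V}_l$; and $z_{N|k}\in\mathbb{Z}_f^{(k)}$. Algorithm. Initialize $\mathbb{Z}_l^{(0)}=\hat{\mathbb{Z}}_l^{(0)}$,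 $\mathbb{Z}_f^{(0)}=\hat{\mathbb{Z}}_f^{(0)}$. At each $k$: solve (OL-SMPC$_k$), obtaining an optimal $\mathbf{c}^*_{N|k}$; apply $u_k=v^*_{0|k}=Kx_k+c^*_{0|k}$; measure $x_{k+1}$ and so obtain $w_k$; update the ambiguity set and compute $\hat{\mathbb{Z}}_l^{(k+1)}$, $\hat{\mathbb{Z}}_f^{(k+1)}$. Safe update: let $\tilde z_{l|k+1}$ be the nominal trajectory from $\tilde z_{0|k+1}=x_{k+1}$ under the candidate $\tilde{\mathbf{c}}_{k+1}=(c^*_{1|k},\dots,c^*_{N-1|k},0)$, i.e. $\tilde z_{l+1|k+1}=\Phi\tilde z_{l|k+1}+B\tilde c_{l|k+1}$. If $\tilde z_{l|k+1}\in\hat{\mathbb{Z}}_l^{(k+1)}$ for $l=1,\dots,N$ and $\tilde z_{N|k+1}\in\hat{\mathbb{Z}}_f^{(k+1)}$, set $\mathbb{Z}_l^{(k+1)}=\hat{\mathbb{Z}}_l^{(k+1)}$ and $\mathbb{Z}_f^{(k+1)}=\hat{\mathbb{Z}}_f^{(k+1)}$; otherwise set $\mathbb{Z}_l^{(k+1)}=\mathbb{Z}_l^{(k)}$ and $\mathbb{Z}_f^{(k+1)}=\mathbb{Z}_f^{(k)}$. *)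

theory Defs
  imports "HOL-Probability.Probability" "HOL-Library.Set_Algebras"
begin

text \<open>
  Minkowski sums are the pointwise operations \<open>+\<close> and \<open>\<Sum>\<close> on sets of
  \<^theory>\<open>HOL-Library.Set_Algebras\<close>; the empty sum is \<open>{0}\<close>. Vector inequalities are
  componentwise. An \<open>n \<times> m\<close> matrix has type \<open>real ^ 'm ^ 'n\<close>.
\<close>

definition pontryagin_diff :: "'a::plus set \<Rightarrow> 'a set \<Rightarrow> 'a set" (infixl \<open>\<ominus>\<^sub>P\<close> 65)
  where "S \<ominus>\<^sub>P T = {a. {a} + T \<subseteq> S}"

text \<open>The operator \<open>^\<close> on matrices would be the entrywise power.\<close>

primrec mat_pow :: "real ^ 'n ^ 'n \<Rightarrow> nat \<Rightarrow> real ^ 'n ^ 'n"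
  where
    "mat_pow M 0 = mat 1"
  | "mat_pow M (Suc i) = M ** mat_pow M i"

definition psd :: "real ^ 'n ^ 'n \<Rightarrow> bool"
  where "psd M \<longleftrightarrow> transpose M = M \<and> (\<forall>v. 0 \<le> v \<bullet> (M *v v))"

definition pd :: "real ^ 'n ^ 'n \<Rightarrow> bool"
  where "pd M \<longleftrightarrow> transpose M = M \<and> (\<forall>v. v \<noteq> 0 \<longrightarrow> 0 < v \<bullet> (M *v v))"

definition loewner_le :: "real ^ 'n ^ 'n \<Rightarrow> real ^ 'n ^ 'n \<Rightarrow> bool"
  where "loewner_le M M' \<longleftrightarrow> psd (M' - M)"

definition psd_sqrt :: "real ^ 'n ^ 'n \<Rightarrow> real ^ 'n ^ 'n"
  where "psd_sqrt M = (THE S. psd S \<and> S ** S = M)"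

definition schur_stable :: "real ^ 'n ^ 'n \<Rightarrow> bool"
  where "schur_stable M \<longleftrightarrow>
    (\<forall>(s::complex) v. v \<noteq> 0 \<and> map_matrix complex_of_real M *v v = s *s v \<longrightarrow> norm s < 1)"

primrec lti_traj ::
  "real ^ 'n ^ 'n \<Rightarrow> real ^ 'm ^ 'n \<Rightarrow> real ^ 'n \<Rightarrow> (nat \<Rightarrow> real ^ 'm) \<Rightarrow> nat \<Rightarrow> real ^ 'n"
  where
    "lti_traj A B x\<^sub>0 u 0 = x\<^sub>0"
  | "lti_traj A B x\<^sub>0 u (Suc k) = A *v lti_traj A B x\<^sub>0 u k + B *v u k"

definition controllable :: "real ^ 'n ^ 'n \<Rightarrow> real ^ 'm ^ 'n \<Rightarrow> bool"
  where "controllable A B \<longleftrightarrow> (\<forall>x\<^sub>0 x\<^sub>1. \<exists>T u. lti_traj A B x\<^sub>0 u T = x\<^sub>1)"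

definition detectable :: "real ^ 'n ^ 'n \<Rightarrow> real ^ 'n ^ 'o \<Rightarrow> bool"
  where "detectable A C \<longleftrightarrow> (\<exists>L. schur_stable (A + L ** C))"

text \<open>The cost takes values in \<^typ>\<open>ennreal\<close>, so that a divergent series has cost \<open>\<infinity>\<close>.\<close>

definition lqr_cost ::
  "real ^ 'n ^ 'n \<Rightarrow> real ^ 'm ^ 'n \<Rightarrow> real ^ 'n ^ 'n \<Rightarrow> real ^ 'm ^ 'm
    \<Rightarrow> real ^ 'n \<Rightarrow> (nat \<Rightarrow> real ^ 'm) \<Rightarrow> ennreal"
  where "lqr_cost A B Q R x\<^sub>0 u =
    (\<Sum>k. ennreal (lti_traj A B x\<^sub>0 u k \<bullet> (Q *v lti_traj A B x\<^sub>0 u k) + u k \<bullet> (R *v u k)))"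

definition lqr_optimal_gain ::
  "real ^ 'n ^ 'n \<Rightarrow> real ^ 'm ^ 'n \<Rightarrow> real ^ 'n ^ 'n \<Rightarrow> real ^ 'm ^ 'm \<Rightarrow> real ^ 'n ^ 'm \<Rightarrow> bool"
  where "lqr_optimal_gain A B Q R K \<longleftrightarrow>
    (\<forall>x\<^sub>0 u. lqr_cost A B Q R x\<^sub>0 (\<lambda>k. K *v (mat_pow (A + B ** K) k *v x\<^sub>0))
              \<le> lqr_cost A B Q R x\<^sub>0 u)"

definition cvar :: "'a measure \<Rightarrow> real \<Rightarrow> ('a \<Rightarrow> real) \<Rightarrow> real"
  where "cvar \<P> \<epsilon> L = (INF \<beta>. \<beta> + 1 / \<epsilon> * (\<integral>w. max (L w - \<beta>) 0 \<partial>\<P>))"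

definition moment_set ::
  "(real ^ 'n) set \<Rightarrow> real ^ 'n \<Rightarrow> real ^ 'n ^ 'n \<Rightarrow> (real ^ 'n) measure set"
  where "moment_set W \<mu> \<Sigma> = {\<rho>. sets \<rho> = sets borel \<and> prob_space \<rho> \<and> measure \<rho> W = 1
    \<and> (\<integral>\<xi>. \<xi> \<partial>\<rho>) = \<mu>
    \<and> loewner_le (\<chi> i j. \<integral>\<xi>. \<xi> $ i * \<xi> $ j \<partial>\<rho>) (\<Sigma> + (\<chi> i j. \<mu> $ i * \<mu> $ j))}"

definition ambiguity_set ::
  "(real ^ 'n) set \<Rightarrow> nat \<Rightarrow> (nat \<Rightarrow> real) \<Rightarrow> (nat \<Rightarrow> real ^ 'n) \<Rightarrow> (nat \<Rightarrow> real ^ 'n ^ 'n)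
    \<Rightarrow> (real ^ 'n) measure set"
  where "ambiguity_set W m \<gamma> \<mu> \<Sigma> = {\<P>. sets \<P> = sets borel
    \<and> (\<exists>\<rho>. (\<forall>j\<in>{1..m}. \<rho> j \<in> moment_set W (\<mu> j) (\<Sigma> j))
          \<and> (\<forall>S\<in>sets borel. emeasure \<P> S = (\<Sum>j=1..m. ennreal (\<gamma> j) * emeasure (\<rho> j) S)))}"

text \<open>
  The supremum is taken in \<^typ>\<open>ereal\<close>. For bounded \<open>W\<close> and a nonempty ambiguity set the minimum
  exists; it is then the worst-case CVaR of \<open>[H]\<^sub>i w\<close>.
\<close>

definition risk_tightening ::
  "real ^ 'n ^ 'p \<Rightarrow> real ^ 'p \<Rightarrow> (real ^ 'n) measure set \<Rightarrow> real ^ 'p"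
  where "risk_tightening H \<epsilon> \<D> =
    (\<chi> i. LEAST \<eta>. (SUP \<P>\<in>\<D>. ereal (cvar \<P> (\<epsilon> $ i) (\<lambda>w. row i H \<bullet> w - \<eta>))) \<le> 0)"

definition worst_case_tightening :: "real ^ 'n ^ 'p \<Rightarrow> (real ^ 'n) set \<Rightarrow> real ^ 'p"
  where "worst_case_tightening H W = (\<chi> i. GREATEST t. t \<in> (\<lambda>\<xi>. row i H \<bullet> \<xi>) ` W)"

definition tightened_state_set ::
  "real ^ 'n ^ 'p \<Rightarrow> real ^ 'p \<Rightarrow> real ^ 'n ^ 'n \<Rightarrow> (real ^ 'n) set \<Rightarrow> real ^ 'p \<Rightarrow> nat
    \<Rightarrow> (real ^ 'n) set"
  where "tightened_state_set H h \<Phi> W \<eta> l =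
    {z. H *v z \<le> h - \<eta>} \<ominus>\<^sub>P (\<Sum>i=1..<l. (*v) (mat_pow \<Phi> i) ` W)"

definition tightened_input_set ::
  "(real ^ 'm) set \<Rightarrow> real ^ 'n ^ 'm \<Rightarrow> real ^ 'n ^ 'n \<Rightarrow> (real ^ 'n) set \<Rightarrow> nat
    \<Rightarrow> (real ^ 'm) set"
  where "tightened_input_set U K \<Phi> W l =
    U \<ominus>\<^sub>P ((*v) K ` (\<Sum>i=0..<l. (*v) (mat_pow \<Phi> i) ` W))"

definition robust_pos_invariant :: "('a \<Rightarrow> 'b \<Rightarrow> 'a) \<Rightarrow> 'a set \<Rightarrow> 'b set \<Rightarrow> 'a set \<Rightarrow> bool"
  where "robust_pos_invariant F X W \<Omega> \<longleftrightarrow> \<Omega> \<subseteq> X \<and> (\<forall>x\<in>\<Omega>. \<forall>w\<in>W. F x w \<in> \<Omega>)"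

definition is_mrpi :: "('a \<Rightarrow> 'b \<Rightarrow> 'a) \<Rightarrow> 'a set \<Rightarrow> 'b set \<Rightarrow> 'a set \<Rightarrow> bool"
  where "is_mrpi F X W \<Omega> \<longleftrightarrow> robust_pos_invariant F X W \<Omega>
    \<and> (\<forall>\<Omega>'. robust_pos_invariant F X W \<Omega>' \<longrightarrow> \<Omega>' \<subseteq> \<Omega>)"

definition mrpi :: "('a \<Rightarrow> 'b \<Rightarrow> 'a) \<Rightarrow> 'a set \<Rightarrow> 'b set \<Rightarrow> 'a set"
  where "mrpi F X W = (THE \<Omega>. is_mrpi F X W \<Omega>)"

lemma is_mrpi_mrpi: "is_mrpi F X W (mrpi F X W)"
  unfolding mrpi_def
proof (rule theI)
  show "is_mrpi F X W (\<Union>{\<Omega>. robust_pos_invariant F X W \<Omega>})"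
    unfolding is_mrpi_def robust_pos_invariant_def by blast
next
  fix \<Omega> assume "is_mrpi F X W \<Omega>"
  moreover have "is_mrpi F X W (\<Union>{\<Omega>. robust_pos_invariant F X W \<Omega>})"
    unfolding is_mrpi_def robust_pos_invariant_def by blast
  ultimately show "\<Omega> = \<Union>{\<Omega>. robust_pos_invariant F X W \<Omega>}"
    unfolding is_mrpi_def by blast
qed

definition terminal_set ::
  "real ^ 'n ^ 'n \<Rightarrow> real ^ 'n ^ 'm \<Rightarrow> nat \<Rightarrow> (real ^ 'n) set \<Rightarrow> (real ^ 'n) set \<Rightarrow> (real ^ 'm) set
    \<Rightarrow> (real ^ 'n) set"
  where "terminal_set \<Phi> K N W Z\<^sub>N V\<^sub>N =
    mrpi (\<lambda>z w. \<Phi> *v z + mat_pow \<Phi> N *v w) {z \<in> Z\<^sub>N. K *v z \<in> V\<^sub>N} W"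

text \<open>
  An input sequence \<open>(c\<^sub>0, \<dots>, c\<^sub>N\<^sub>-\<^sub>1)\<close> is a list of length \<open>N\<close>; \<open>Z\<close> and \<open>V\<close> are
  indexed by the prediction step, and \<open>Z 0\<close> is not used.
\<close>

definition smpc_feasible ::
  "real ^ 'n ^ 'n \<Rightarrow> real ^ 'm ^ 'n \<Rightarrow> real ^ 'n ^ 'm \<Rightarrow> nat \<Rightarrow> (nat \<Rightarrow> (real ^ 'm) set)
    \<Rightarrow> (nat \<Rightarrow> (real ^ 'n) set) \<Rightarrow> (real ^ 'n) set \<Rightarrow> real ^ 'n \<Rightarrow> (real ^ 'm) list set"
  where "smpc_feasible A B K N V Z Zf x = {c. length c = N
    \<and> (\<exists>z v. z 0 = x
          \<and> (\<forall>l<N. z (Suc l) = A *v z l + B *v v l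
                 \<and> v l = K *v z l + c ! l
                 \<and> z (Suc l) \<in> Z (Suc l)
                 \<and> v l \<in> V l)
          \<and> z N \<in> Zf)}"

definition smpc_cost ::
  "real ^ 'm ^ 'n \<Rightarrow> real ^ 'm ^ 'm \<Rightarrow> real ^ 'n ^ 'n \<Rightarrow> nat \<Rightarrow> (real ^ 'm) list \<Rightarrow> real"
  where "smpc_cost B R P N c =
    (\<Sum>l<N. (c ! l) \<bullet> ((R + transpose B ** P ** B) *v (c ! l)))"

text \<open>
  \<open>x\<close> is the successor state, \<open>c\<close> the shifted candidate, \<open>(Zh, Zfh)\<close> the newly learned sets,
  \<open>(Z, Zf)\<close> the sets in use and \<open>(Z', Zf')\<close> the sets used next.
\<close>

definition safe_update ::
  "real ^ 'n ^ 'n \<Rightarrow> real ^ 'm ^ 'n \<Rightarrow> nat \<Rightarrow> real ^ 'n \<Rightarrow> (real ^ 'm) list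
    \<Rightarrow> (nat \<Rightarrow> (real ^ 'n) set) \<Rightarrow> (real ^ 'n) set
    \<Rightarrow> (nat \<Rightarrow> (real ^ 'n) set) \<Rightarrow> (real ^ 'n) set
    \<Rightarrow> (nat \<Rightarrow> (real ^ 'n) set) \<Rightarrow> (real ^ 'n) set \<Rightarrow> bool"
  where "safe_update \<Phi> B N x c Zh Zfh Z Zf Z' Zf' \<longleftrightarrow>
    (let z = lti_traj \<Phi> B x (\<lambda>l. c ! l) in
      if (\<forall>l\<in>{1..N}. z l \<in> Zh l) \<and> z N \<in> Zfh
      then (\<forall>l\<in>{1..N}. Z' l = Zh l) \<and> Zf' = Zfh
      else (\<forall>l\<in>{1..N}. Z' l = Z l) \<and> Zf' = Zf)"

end

theory Submission
  imports Defs
begin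

text \<open>
  The shifted candidate \<open>(c\<^sub>1, \<dots>, c\<^sub>N\<^sub>-\<^sub>1, 0)\<close> stays feasible for the sets in use: the
  realized disturbance moves the \<open>l\<close>-th predicted state by \<open>\<Phi>\<^sup>l w\<close>, which is exactly
  the term by which the tightening grows from step \<open>l\<close> to step \<open>l + 1\<close>, and the last step is
  covered by the robust invariance of the terminal set. The safe update passes to new sets only if
  the candidate satisfies them, while the input sets do not depend on time. The only property
  of the learned tightenings that must be carried along is that the sets in use were all computed
  from one common vector \<open>\<eta>\<close>.
\<close>

lemma mem_pontryagin_diff_iff: "a \<in> S \<ominus>\<^sub>P T \<longleftrightarrow> (\<forall>t\<in>T. a + t \<in> S)"
  by (auto simp: pontryagin_diff_def set_plus_def)

text \<open>A realized disturbance \<open>t'\<close> uses up one summand of the subtracted Minkowski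
  sum. The two step lemmas below take \<open>T'\<close> to be the last summand.\<close>

lemma add_mem_pontryagin_diff:
  fixes S :: "'a::ab_semigroup_add set"
  assumes "a \<in> S \<ominus>\<^sub>P (T + T')" and "t' \<in> T'"
  shows "a + t' \<in> S \<ominus>\<^sub>P T"
  using assms by (fastforce simp: mem_pontryagin_diff_iff set_plus_def add_ac)

text \<open>The sum subtracted at \<open>Suc l\<close> has the extra summand of index
  \<open>l\<close>. The bound on \<open>l\<close> matters: the sums start at index 1, so for
  \<open>l = 0\<close> both are empty and leave no slack to absorb \<open>w\<close>.\<close>

lemma tightened_state_set_step:
  assumes "z \<in> tightened_state_set H h \<Phi> W \<eta> (Suc l)" "w \<in> W" "1 \<le> l"
  shows "z + mat_pow \<Phi> l *v w \<in> tightened_state_set H h \<Phi> W \<eta> l"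
  using assms unfolding tightened_state_set_def
  by (auto intro: add_mem_pontryagin_diff)

text \<open>Here the sums start at index 0, so there is slack at \<open>l = 0\<close> too. By
  linearity of \<open>K\<close>, the image of the Minkowski sum still splits off its last
  summand.\<close>

lemma tightened_input_set_step:
  assumes "v \<in> tightened_input_set U K \<Phi> W (Suc l)" "w \<in> W"
  shows "v + K *v (mat_pow \<Phi> l *v w) \<in> tightened_input_set U K \<Phi> W l"
proof -
  have "(*v) K ` (\<Sum>i=0..<Suc l. (*v) (mat_pow \<Phi> i) ` W)
      = (*v) K ` (\<Sum>i=0..<l. (*v) (mat_pow \<Phi> i) ` W) + (*v) K ` (*v) (mat_pow \<Phi> l) ` W"
    by (simp add: set_plus_image image_image case_prod_unfold matrix_vector_right_distrib)
       (force simp: set_plus_def matrix_vector_right_distrib image_iff)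
  then show ?thesis
    using assms unfolding tightened_input_set_def
    by (auto intro: add_mem_pontryagin_diff)
qed

text \<open>The maximal set is itself robustly invariant, by \<open>is_mrpi_mrpi\<close>. The
  disturbance enters through \<open>mat_pow \<Phi> N\<close> because, when the shifted horizon ends,
  it has passed through \<open>N\<close> closed-loop steps.\<close>

lemma
  assumes "z \<in> terminal_set \<Phi> K N W ZN VN"
  shows terminal_set_state: "z \<in> ZN"
    and terminal_set_input: "K *v z \<in> VN"
    and terminal_set_invariant: "w \<in> W \<Longrightarrow>
      \<Phi> *v z + mat_pow \<Phi> N *v w \<in> terminal_set \<Phi> K N W ZN VN"
  using assms is_mrpi_mrpi[of "\<lambda>z w. \<Phi> *v z + mat_pow \<Phi> N *v w" "{z \<in> ZN. K *v z \<in> VN}" W]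
  unfolding terminal_set_def is_mrpi_def robust_pos_invariant_def by auto

text \<open>The state and the input sequence determine the nominal trajectory, so the existential
  disappears. Substituting the feedback yields the closed-loop recursion that
  \<open>safe_update\<close> tests.\<close>

lemma smpc_feasible_iff:
  fixes A :: "real ^ 'n ^ 'n" and B :: "real ^ 'm ^ 'n" and K :: "real ^ 'n ^ 'm"
  defines "z \<equiv> \<lambda>x c. lti_traj (A + B ** K) B x (\<lambda>l. c ! l)"
  shows "c \<in> smpc_feasible A B K N V Z Zf x \<longleftrightarrow>
    length c = N
    \<and> (\<forall>l<N. z x c (Suc l) \<in> Z (Suc l) \<and> K *v z x c l + c ! l \<in> V l) \<and> z x c N \<in> Zf"
    (is "_ \<longleftrightarrow> ?R")
proof
  assume "c \<in> smpc_feasible A B K N V Z Zf x"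
  then obtain y v where y0: "y 0 = x" and len: "length c = N" and yN: "y N \<in> Zf"
    and step: "\<And>l. l < N \<Longrightarrow> y (Suc l) = A *v y l + B *v v l \<and> v l = K *v y l + c ! l
      \<and> y (Suc l) \<in> Z (Suc l) \<and> v l \<in> V l"
    unfolding smpc_feasible_def by auto
  have y: "y l = z x c l" if "l \<le> N" for l
    using that
    by (induction l) (use y0 step in \<open>simp_all add: z_def algebra_simps matrix_vector_mul_assoc\<close>)
  show ?R
    using len step yN y by (metis Suc_leI less_imp_le order_refl)
next
  assume ?R
  moreover have "z x c (Suc l) = A *v z x c l + B *v (K *v z x c l + c ! l)" for l
    by (simp add: z_def algebra_simps matrix_vector_mul_assoc)
  moreover have "z x c 0 = x"
    by (simp add: z_def)
  ultimately show "c \<in> smpc_feasible A B K N V Z Zf x"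
    unfolding smpc_feasible_def
    by (auto intro!: exI[of _ "z x c"] exI[of _ "\<lambda>l. K *v z x c l + c ! l"])
qed

text \<open>Both trajectories receive the same inputs, so their difference evolves under \<Phi>
  alone, starting from \<open>w\<close>. State \<open>l\<close> reads only the first
  \<open>l\<close> entries of the shifted list; for \<open>l < N\<close> the appended 0 is not among
  them.\<close>

lemma lti_traj_shift:
  assumes "length c = N" "l < N"
  shows "lti_traj \<Phi> B (\<Phi> *v x + B *v (c ! 0) + w) (\<lambda>l. (tl c @ [0]) ! l) l
    = lti_traj \<Phi> B x (\<lambda>l. c ! l) (Suc l) + mat_pow \<Phi> l *v w"
  using assms(2)
proof (induction l)
  case 0
  then show ?case by simp
next
  case (Suc l)
  then have "(tl c @ [0]) ! l = c ! Suc l"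
    using assms(1) by (auto simp: nth_append nth_tl)
  with Suc show ?case
    by (simp add: algebra_simps matrix_vector_mul_assoc)
qed

lemma shifted_candidate_feasible:
  fixes A :: "real ^ 'n ^ 'n" and B :: "real ^ 'm ^ 'n" and K :: "real ^ 'n ^ 'm"
  defines "\<Phi> \<equiv> A + B ** K"
  assumes N: "1 \<le> N"
    and V: "\<And>l. V l = tightened_input_set U K \<Phi> W l"
    and Z: "\<And>l. l \<in> {1..N} \<Longrightarrow> Z l = tightened_state_set H h \<Phi> W \<eta> l"
    and Zf: "Zf = terminal_set \<Phi> K N W (tightened_state_set H h \<Phi> W \<eta> N) (V N)"
    and c: "c \<in> smpc_feasible A B K N V Z Zf x"
    and w: "w \<in> W"
  shows "tl c @ [0] \<in> smpc_feasible A B K N V Z Zf (\<Phi> *v x + B *v (c ! 0) + w)"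
proof -
  define z where "z = lti_traj \<Phi> B x (\<lambda>l. c ! l)"
  define z' where "z' = lti_traj \<Phi> B (\<Phi> *v x + B *v (c ! 0) + w) (\<lambda>l. (tl c @ [0]) ! l)"
  have len: "length c = N" and zN: "z N \<in> Zf"
    and zZ: "\<And>l. l < N \<Longrightarrow> z (Suc l) \<in> Z (Suc l)"
    and zV: "\<And>l. l < N \<Longrightarrow> K *v z l + c ! l \<in> V l"
    using c unfolding smpc_feasible_iff z_def \<Phi>_def by auto
  have shift: "z' l = z (Suc l) + mat_pow \<Phi> l *v w" if "l < N" for l
    using lti_traj_shift[OF len that] unfolding z_def z'_def .
  have nth: "(tl c @ [0]) ! l = (if Suc l < N then c ! Suc l else 0)" if "l < N" for l
    using len that by (auto simp: nth_append nth_tl not_less Suc_le_eq)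
  obtain M where M: "N = Suc M"
    using N by (cases N) auto
  \<comment> \<open>\<open>shift\<close> ends at \<open>M = N - 1\<close>. The last step is driven
    by the appended 0, hence is a pure closed-loop step.\<close>
  have z'N: "z' N = \<Phi> *v z N + mat_pow \<Phi> N *v w"
  proof -
    have "z' N = \<Phi> *v z' M + B *v ((tl c @ [0]) ! M)"
      unfolding M z'_def by simp
    also have "\<dots> = \<Phi> *v (z N + mat_pow \<Phi> M *v w)"
      using nth[of M] shift[of M] by (simp add: M)
    finally show ?thesis
      by (simp add: M matrix_vector_right_distrib matrix_vector_mul_assoc)
  qed
  have z'Zf: "z' N \<in> Zf"
    using zN w unfolding z'N Zf by (rule terminal_set_invariant)
  have z'Z: "z' (Suc l) \<in> Z (Suc l)" if l: "l < N" for l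
  proof (cases "Suc l < N")
    case True
    then show ?thesis
      using zZ[of "Suc l"] w Z[of "Suc l"] Z[of "Suc (Suc l)"] shift[of "Suc l"]
      by (simp add: tightened_state_set_step del: mat_pow.simps)
  next
    case False
    \<comment> \<open>The final state is in the terminal set, which lies inside the state set of
      step \<open>N\<close>.\<close>
    then have "Suc l = N"
      using l by simp
    with z'Zf show ?thesis
      using terminal_set_state Z[of N] N unfolding Zf by force
  qed
  have z'V: "K *v z' l + (tl c @ [0]) ! l \<in> V l" if l: "l < N" for l
  proof -
    \<comment> \<open>Without the disturbance, the input meets the tighter constraint of the next
      step: by feasibility of \<open>c\<close> inside the horizon, and by the terminal input
      constraint at its end, where the input is \<open>K *v z N\<close>.\<close>
    have "K *v z (Suc l) + (tl c @ [0]) ! l \<in> V (Suc l)"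
    proof (cases "Suc l < N")
      case True
      then show ?thesis
        using zV[of "Suc l"] nth[OF l] by simp
    next
      case False
      then have "Suc l = N"
        using l by simp
      then show ?thesis
        using terminal_set_input[OF zN[unfolded Zf]] nth[OF l] by simp
    qed
    from tightened_input_set_step[OF this[unfolded V] w] show ?thesis
      by (simp add: V shift[OF l] algebra_simps)
  qed
  show ?thesis
    using z'Zf z'Z z'V len N unfolding smpc_feasible_iff z'_def \<Phi>_def by auto
qed

text \<open>A successful test checks exactly the state and terminal constraints of the new problem
  along the candidate's trajectory; a failed one leaves the sets as they were. The input sets are
  common to both problems.\<close>

lemma safe_update_feasible:
  fixes A :: "real ^ 'n ^ 'n" and B :: "real ^ 'm ^ 'n" and K :: "real ^ 'n ^ 'm"
  assumes c: "c \<in> smpc_feasible A B K N V Z Zf x"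
    and update: "safe_update (A + B ** K) B N x c Zh Zfh Z Zf Z' Zf'"
  shows "c \<in> smpc_feasible A B K N V Z' Zf' x"
proof -
  have "\<And>l. l < N \<Longrightarrow> Suc l \<in> {1..N}"
    by auto
  with c update show ?thesis
    unfolding smpc_feasible_iff safe_update_def Let_def by (smt (verit, best))
qed

theorem theorem2:
  fixes A :: "real ^ 'n ^ 'n" and B :: "real ^ 'm ^ 'n"
    and Q P \<Phi> :: "real ^ 'n ^ 'n" and R :: "real ^ 'm ^ 'm" and K :: "real ^ 'n ^ 'm"
    and E :: "real ^ 'n ^ 'r" and f :: "real ^ 'r"
    and H :: "real ^ 'n ^ 'p" and h \<epsilon> :: "real ^ 'p"
    and G :: "real ^ 'm ^ 'q" and g :: "real ^ 'q"
    and W X :: "(real ^ 'n) set" and U :: "(real ^ 'm) set"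
    and N :: nat
    and m :: "nat \<Rightarrow> nat" and \<gamma> :: "nat \<Rightarrow> nat \<Rightarrow> real"
    and \<mu> :: "nat \<Rightarrow> nat \<Rightarrow> real ^ 'n" and \<Sigma> :: "nat \<Rightarrow> nat \<Rightarrow> real ^ 'n ^ 'n"
    and \<eta> :: "nat \<Rightarrow> real ^ 'p"
    and Zhat Z :: "nat \<Rightarrow> nat \<Rightarrow> (real ^ 'n) set" and Zfhat Zf :: "nat \<Rightarrow> (real ^ 'n) set"
    and V :: "nat \<Rightarrow> (real ^ 'm) set"
    and \<D> :: "nat \<Rightarrow> real ^ 'n \<Rightarrow> (real ^ 'm) list set"
    and x w :: "nat \<Rightarrow> real ^ 'n" and u :: "nat \<Rightarrow> real ^ 'm" and c :: "nat \<Rightarrow> (real ^ 'm) list"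
  assumes controllable: "controllable A B"
    and W: "W = {w. E *v w \<le> f}" "bounded W" "convex W" "0 \<in> interior W"
    and cost_matrices: "pd Q" "pd R"
    and detectable: "detectable A (psd_sqrt Q)"
    and X: "X = {x. H *v x \<le> h}" "polytope X" "0 \<in> interior X"
    and U: "U = {u. G *v u \<le> g}" "polytope U" "0 \<in> interior U"
    and gain: "lqr_optimal_gain A B Q R K"
    and \<Phi>: "\<Phi> = A + B ** K" "schur_stable \<Phi>"
    and P: "transpose \<Phi> ** P ** \<Phi> + Q + transpose K ** R ** K = P"
    and horizon: "1 \<le> N"
    and risk_levels: "\<forall>i. 0 < \<epsilon> $ i \<and> \<epsilon> $ i < 1"
    and weights: "\<forall>k. (\<forall>j\<in>{1..m k}. 0 \<le> \<gamma> k j) \<and> (\<Sum>j=1..m k. \<gamma> k j) = 1"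
    and covariances: "\<forall>k. \<forall>j\<in>{1..m k}. psd (\<Sigma> k j)"
    and \<eta>: "\<eta> = (\<lambda>k. risk_tightening H \<epsilon> (ambiguity_set W (m k) (\<gamma> k) (\<mu> k) (\<Sigma> k)))"
    and Zhat: "Zhat = (\<lambda>k l. tightened_state_set H h \<Phi> W (\<eta> k) l)"
    and V: "V = (\<lambda>l. tightened_input_set U K \<Phi> W l)"
    and Zfhat: "Zfhat = (\<lambda>k. terminal_set \<Phi> K N W (Zhat k N) (V N))"
    and worst_case_terminal:
      "terminal_set \<Phi> K N W
        (tightened_state_set H h \<Phi> W (worst_case_tightening H W) N) (V N) \<noteq> {}"
    and feasible_region: "\<D> = (\<lambda>k \<xi>. smpc_feasible A B K N V (Z k) (Zf k) \<xi>)"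
    and plant: "\<forall>k. w k \<in> W \<and> x (Suc k) = A *v x k + B *v u k + w k"
    and initial_sets: "(\<forall>l\<in>{1..N}. Z 0 l = Zhat 0 l) \<and> Zf 0 = Zfhat 0"
    and control_law: "\<forall>k. \<D> k (x k) \<noteq> {} \<longrightarrow>
        is_arg_min (smpc_cost B R P N) (\<lambda>c'. c' \<in> \<D> k (x k)) (c k)
        \<and> u k = K *v x k + c k ! 0"
    and set_update: "\<forall>k. \<D> k (x k) \<noteq> {} \<longrightarrow>
        safe_update \<Phi> B N (x (Suc k)) (tl (c k) @ [0])
          (Zhat (Suc k)) (Zfhat (Suc k)) (Z k) (Zf k) (Z (Suc k)) (Zf (Suc k))"
    and initially_feasible: "\<D> 0 (x 0) \<noteq> {}"
  shows "\<forall>k. \<D> k (x k) \<noteq> {}"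
proof -
  \<comment> \<open>The index \<open>j\<close> is a time whose learned sets are in use at time
    \<open>k\<close>; it supplies the common vector \<open>\<eta> j\<close>.\<close>
  define sets_from where "sets_from = (\<lambda>k j. (\<forall>l\<in>{1..N}. Z k l = Zhat j l) \<and> Zf k = Zfhat j)"
  have "\<D> k (x k) \<noteq> {} \<and> (\<exists>j. sets_from k j)" for k
  proof (induction k)
    case 0
    show ?case
      using initially_feasible initial_sets unfolding sets_from_def by blast
  next
    case (Suc k)
    then obtain j where j: "sets_from k j"
      by blast
    have ck: "c k \<in> smpc_feasible A B K N V (Z k) (Zf k) (x k)"
      and uk: "u k = K *v x k + c k ! 0"
      using Suc control_law unfolding feasible_region is_arg_min_def by auto
    have update: "safe_update \<Phi> B N (x (Suc k)) (tl (c k) @ [0])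
        (Zhat (Suc k)) (Zfhat (Suc k)) (Z k) (Zf k) (Z (Suc k)) (Zf (Suc k))"
      using Suc set_update by blast
    have "x (Suc k) = \<Phi> *v x k + B *v (c k ! 0) + w k"
      using plant by (simp add: uk \<Phi>(1) algebra_simps matrix_vector_mul_assoc)
    moreover have "tl (c k) @ [0]
        \<in> smpc_feasible A B K N V (Z k) (Zf k) (\<Phi> *v x k + B *v (c k ! 0) + w k)"
      unfolding \<Phi>(1)
    proof (rule shifted_candidate_feasible[OF horizon _ _ _ ck])
      show "V l = tightened_input_set U K (A + B ** K) W l" for l
        by (simp add: V \<Phi>(1))
      show "Z k l = tightened_state_set H h (A + B ** K) W (\<eta> j) l" if "l \<in> {1..N}" for l
        using j that by (simp add: sets_from_def Zhat \<Phi>(1))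
      show "Zf k = terminal_set (A + B ** K) K N W
          (tightened_state_set H h (A + B ** K) W (\<eta> j) N) (V N)"
        using j by (simp add: sets_from_def Zfhat Zhat \<Phi>(1))
      show "w k \<in> W"
        using plant by blast
    qed
    ultimately have "tl (c k) @ [0] \<in> \<D> (Suc k) (x (Suc k))"
      using update unfolding feasible_region \<Phi>(1) by (metis safe_update_feasible)
    \<comment> \<open>An accepted update resets this time to \<open>Suc k\<close>, a rejected one
      keeps \<open>j\<close>.\<close>
    moreover have "sets_from (Suc k) (Suc k) \<or> sets_from (Suc k) j"
      using update j unfolding safe_update_def sets_from_def Let_def by (auto split: if_splits)
    ultimately show ?case
      by blast
  qed
  then show ?thesis
    by blast
qed

end
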